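(* Let $C$ be a linear code of length $n$ over a finite commutative principal ideal ring $R$, and let $\lambda$ be a positive integer. Then $$\mathrm{swe}^{[\lambda]}_{C^\perp}(\mathbf{x})=\frac{1}{|C|^\lambda}\,\mathrm{swe}^{[\lambda]}_C\big(\mathbf{Q}\mathbf{D}^\lambda\mathbf{A}^{-1}\mathbf{x}\big),$$ where $\mathbf{Q},\mathbf{D},\mathbf{A}$ are the $(t+1)\times(t+1)$ matrices with rows and columns indexed by $\{0,1,\dots,t\}$ defined as follows: $\mathbf A$ has $(i,j)$ entry $1$ if $a_iR\subseteq a_jR$ and $0$ otherwise; $\mathbf D$ is diagonal with diagonal entries $|a_0R|,\dots,|a_tR|$; and $\mathbf Q$ has $(i,j)$ entry $1$ if $a_jR\subseteq(a_iR)^\perp$ and $0$ otherwise.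
   Context: Rings have an identity. A finite commutative principal ideal ring is a finite commutative ring in which every ideal has the form $aR=\{ab:b\in R\}$ for some $a\in R$. A linear code $C$ of length $n$ over $R$ is an $R$-submodule of $R^n$; $C^\perp=\{\mathbf v\in R^n: \sum_{\ell=1}^n u_\ell v_\ell=0\text{ for all }\mathbf u\in C\}$. For $c\in R$, $(cR)^\perp=\{r\in R: cr=0\}$. Let $[n]=\{1,\dots,n\}$. Let $t$ be the number of nonzero principal ideals of $R$ and let $a_0,\dots,a_t\in R$ be fixed elements such that $a_0R,\dots,a_tR$ are pairwise distinct (hence are all the principal ideals of $R$). For $\mathbf c_m=(c_{m1},\dots,c_{mn})\in C$, $m=1,\dots,\lambda$, let $$S^{[\lambda]}_i(\mathbf c_1,\dots,\mathbf c_\lambda)=\{\ell\in[n]: c_{1\ell}R+\cdots+c_{\lambda\ell}R=a_iR\},\qquad 0\le i\le t.$$ With $\mathbf x=(x_0,\dots,x_t)^T$ a column vector of indeterminates, the $\lambda$-tuple symmetrized weight enumerator of $C$ is $$\mathrm{swe}^{[\lambda]}_C(\mathbf x)=\sum_{(\mathbf c_1,\dots,\mathbf c_\lambda)\in C^\lambda}\ \prod_{i=0}^t x_i^{|S^{[\lambda]}_i(\mathbf c_1,\dots,\mathbf c_\lambda)|}.$$ For a $(t+1)\times(t+1)$ matrix $\mathbf M$, $\mathrm{swe}^{[\lambda]}_C(\mathbf M\mathbf x)$ means substituting the $i$-th entry of $\mathbf M\mathbf x$ for $x_i$. The matrix $\mathbf A$ is invertible. *)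

theory Defs
  imports
    "HOL-Algebra.Ideal"
    "HOL-Algebra.Module"
    "HOL-Library.Poly_Mapping"
    "Jordan_Normal_Form.Gauss_Jordan_Elimination"
begin

section \<open>Finite principal ideal rings and linear codes\<close>

text \<open>The zero ring is included.\<close>

locale finite_principal_ideal_ring = cring +
  assumes finite_carrier: "finite (carrier R)"
    and ideal_principal: "ideal I R \<Longrightarrow> \<exists>a\<in>carrier R. I = PIdl a"

text \<open>
  Words of length \<open>n\<close> are extensional functions on \<open>{1..n}\<close>. The multiplicative fields of the
  record play no role in a module and are left unspecified.
\<close>

definition word_module :: "('a, 'm) ring_scheme \<Rightarrow> nat \<Rightarrow> ('a, nat \<Rightarrow> 'a) module" where
  "word_module R n =
    \<lparr> carrier = {1..n} \<rightarrow>\<^sub>E carrier R,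
      monoid.mult = undefined,
      one = undefined,
      zero = (\<lambda>l\<in>{1..n}. \<zero>\<^bsub>R\<^esub>),
      add = (\<lambda>u v. \<lambda>l\<in>{1..n}. u l \<oplus>\<^bsub>R\<^esub> v l),
      smult = (\<lambda>r v. \<lambda>l\<in>{1..n}. r \<otimes>\<^bsub>R\<^esub> v l) \<rparr>"

lemma module_word_module:
  fixes R (structure)
  assumes "cring R"
  shows "module R (word_module R n)"
proof -
  interpret cring R by fact
  have ops [simp]:
    "carrier (word_module R n) = {1..n} \<rightarrow>\<^sub>E carrier R"
    "\<zero>\<^bsub>word_module R n\<^esub> = (\<lambda>l\<in>{1..n}. \<zero>)"
    "u \<oplus>\<^bsub>word_module R n\<^esub> v = (\<lambda>l\<in>{1..n}. u l \<oplus> v l)"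
    "r \<odot>\<^bsub>word_module R n\<^esub> v = (\<lambda>l\<in>{1..n}. r \<otimes> v l)" for u v r
    by (simp_all add: word_module_def)
  have mem: "u l \<in> carrier R" if "u \<in> {1..n} \<rightarrow>\<^sub>E carrier R" "1 \<le> l" "l \<le> n" for u l
    using that by (auto simp: PiE_iff)
  have add: "(\<lambda>l\<in>{1..n}. u l \<oplus> v l) \<in> {1..n} \<rightarrow>\<^sub>E carrier R"
    if "u \<in> {1..n} \<rightarrow>\<^sub>E carrier R" "v \<in> {1..n} \<rightarrow>\<^sub>E carrier R" for u v
    using that by (intro restrict_PiE_iff[THEN iffD2]) (simp add: mem)
  have smult: "(\<lambda>l\<in>{1..n}. r \<otimes> v l) \<in> {1..n} \<rightarrow>\<^sub>E carrier R"
    if "r \<in> carrier R" "v \<in> {1..n} \<rightarrow>\<^sub>E carrier R" for r v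
    using that by (intro restrict_PiE_iff[THEN iffD2]) (simp add: mem)
  show ?thesis
  proof (rule moduleI)
    show "cring R" by fact
    show "abelian_group (word_module R n)"
    proof (rule abelian_groupI; unfold ops)
      fix x assume x: "x \<in> {1..n} \<rightarrow>\<^sub>E carrier R"
      have neg: "(\<lambda>l\<in>{1..n}. \<ominus> x l) \<in> {1..n} \<rightarrow>\<^sub>E carrier R"
        using x by (intro restrict_PiE_iff[THEN iffD2]) (simp add: mem)
      show "\<exists>y\<in>{1..n} \<rightarrow>\<^sub>E carrier R. (\<lambda>l\<in>{1..n}. y l \<oplus> x l) = (\<lambda>l\<in>{1..n}. \<zero>)"
        using x by (intro bexI[OF _ neg] restrict_ext) (simp add: mem l_neg)
    next
      fix x y assume "x \<in> {1..n} \<rightarrow>\<^sub>E carrier R" "y \<in> {1..n} \<rightarrow>\<^sub>E carrier R"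
      then show "(\<lambda>l\<in>{1..n}. x l \<oplus> y l) \<in> {1..n} \<rightarrow>\<^sub>E carrier R" by (rule add)
    next
      show "(\<lambda>l\<in>{1..n}. \<zero>) \<in> {1..n} \<rightarrow>\<^sub>E carrier R"
        by (intro restrict_PiE_iff[THEN iffD2]) simp
    next
      fix x y z
      assume "x \<in> {1..n} \<rightarrow>\<^sub>E carrier R" "y \<in> {1..n} \<rightarrow>\<^sub>E carrier R" "z \<in> {1..n} \<rightarrow>\<^sub>E carrier R"
      then show "(\<lambda>l\<in>{1..n}. (\<lambda>l\<in>{1..n}. x l \<oplus> y l) l \<oplus> z l) =
          (\<lambda>l\<in>{1..n}. x l \<oplus> (\<lambda>l\<in>{1..n}. y l \<oplus> z l) l)"
        by (intro restrict_ext) (simp add: mem a_assoc)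
    next
      fix x y assume "x \<in> {1..n} \<rightarrow>\<^sub>E carrier R" "y \<in> {1..n} \<rightarrow>\<^sub>E carrier R"
      then show "(\<lambda>l\<in>{1..n}. x l \<oplus> y l) = (\<lambda>l\<in>{1..n}. y l \<oplus> x l)"
        by (intro restrict_ext) (simp add: mem a_comm)
    next
      fix x assume x: "x \<in> {1..n} \<rightarrow>\<^sub>E carrier R"
      then have "(\<lambda>l\<in>{1..n}. (\<lambda>l\<in>{1..n}. \<zero>) l \<oplus> x l) = restrict x {1..n}"
        by (intro restrict_ext) (simp add: mem)
      also have "\<dots> = x"
        using x by (rule PiE_restrict)
      finally show "(\<lambda>l\<in>{1..n}. (\<lambda>l\<in>{1..n}. \<zero>) l \<oplus> x l) = x" .
    qed
  next
    fix x assume x: "x \<in> carrier (word_module R n)"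
    then have "\<one> \<odot>\<^bsub>word_module R n\<^esub> x = restrict x {1..n}"
      unfolding ops by (intro restrict_ext) (simp add: mem)
    also have "\<dots> = x"
      using x unfolding ops by (rule PiE_restrict)
    finally show "\<one> \<odot>\<^bsub>word_module R n\<^esub> x = x" .
  qed (unfold ops, (erule (1) smult | intro restrict_ext, simp add: mem l_distr r_distr m_assoc)+)
qed

definition linear_code :: "('a, 'm) ring_scheme \<Rightarrow> nat \<Rightarrow> (nat \<Rightarrow> 'a) set \<Rightarrow> bool" where
  "linear_code R n C \<longleftrightarrow> submodule C R (word_module R n)"

definition dual_code ::
    "('a, 'm) ring_scheme \<Rightarrow> nat \<Rightarrow> (nat \<Rightarrow> 'a) set \<Rightarrow> (nat \<Rightarrow> 'a) set" where
  "dual_code R n C =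
    {v \<in> {1..n} \<rightarrow>\<^sub>E carrier R. \<forall>u\<in>C. (\<Oplus>\<^bsub>R\<^esub>l\<in>{1..n}. u l \<otimes>\<^bsub>R\<^esub> v l) = \<zero>\<^bsub>R\<^esub>}"

text \<open>The set \<open>(cR)\<^sup>\<bottom>\<close>; it depends on \<open>c\<close> only through the ideal \<open>cR\<close>.\<close>

definition annihilator :: "('a, 'm) ring_scheme \<Rightarrow> 'a \<Rightarrow> 'a set" where
  "annihilator R c = {r \<in> carrier R. c \<otimes>\<^bsub>R\<^esub> r = \<zero>\<^bsub>R\<^esub>}"

definition ideal_sum ::
    "('a, 'm) ring_scheme \<Rightarrow> 'i set \<Rightarrow> ('i \<Rightarrow> 'a set) \<Rightarrow> 'a set" where
  "ideal_sum R M J = {(\<Oplus>\<^bsub>R\<^esub>m\<in>M. f m) | f. f \<in> (\<Pi> m\<in>M. J m)}"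

definition num_nonzero_principal_ideals :: "('a, 'm) ring_scheme \<Rightarrow> nat" where
  "num_nonzero_principal_ideals R =
    card {I. (\<exists>b\<in>carrier R. I = PIdl\<^bsub>R\<^esub> b) \<and> I \<noteq> {\<zero>\<^bsub>R\<^esub>}}"


section \<open>Symmetrized weight enumerators\<close>

text \<open>The tuple \<open>(c\<^sub>1, \<dots>, c\<^sub>\<lambda>)\<close> is \<open>c\<close>, with \<open>k\<close> for \<open>\<lambda>\<close>: \<open>c m l\<close> is the \<open>l\<close>-th coordinate of
  the \<open>m\<close>-th word.\<close>

definition ideal_positions ::
    "('a, 'm) ring_scheme \<Rightarrow> nat \<Rightarrow> (nat \<Rightarrow> 'a) \<Rightarrow> nat \<Rightarrow> (nat \<Rightarrow> nat \<Rightarrow> 'a) \<Rightarrow> nat \<Rightarrow> nat set"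
  where
  "ideal_positions R n a k c i =
    {l \<in> {1..n}. ideal_sum R {1..k} (\<lambda>m. PIdl\<^bsub>R\<^esub> (c m l)) = PIdl\<^bsub>R\<^esub> (a i)}"

text \<open>
  The last argument \<open>x\<close> is what stands for the variables: for the vector \<open>indets t\<close> defined below
  this is the enumerator as a polynomial, for another vector of polynomials it is the result of
  substituting its entries for the variables.
\<close>

definition swe ::
    "('a, 'm) ring_scheme \<Rightarrow> nat \<Rightarrow> nat \<Rightarrow> (nat \<Rightarrow> 'a) \<Rightarrow> nat \<Rightarrow> (nat \<Rightarrow> 'a) set
      \<Rightarrow> 'b::comm_ring_1 vec \<Rightarrow> 'b" where
  "swe R n t a k C x =
    (\<Sum>c \<in> {1..k} \<rightarrow>\<^sub>E C. \<Prod>i\<in>{0..t}. (x $ i) ^ card (ideal_positions R n a k c i))"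

text \<open>
  Polynomials with rational coefficients in indeterminates indexed by natural numbers: finitely
  supported maps from exponent vectors to coefficients, with the convolution product.
\<close>

type_synonym rat_mpoly = "(nat \<Rightarrow>\<^sub>0 nat) \<Rightarrow>\<^sub>0 rat"

definition Const :: "rat \<Rightarrow> rat_mpoly" where
  "Const q = Poly_Mapping.single 0 q"

definition Indet :: "nat \<Rightarrow> rat_mpoly" where
  "Indet i = Poly_Mapping.single (Poly_Mapping.single i 1) 1"

definition indets :: "nat \<Rightarrow> rat_mpoly vec" where
  "indets t = vec (t + 1) Indet"


section \<open>The three matrices\<close>

definition A_mat :: "('a, 'm) ring_scheme \<Rightarrow> nat \<Rightarrow> (nat \<Rightarrow> 'a) \<Rightarrow> rat mat" where
  "A_mat R t a =
    mat (t + 1) (t + 1) (\<lambda>(i, j). if PIdl\<^bsub>R\<^esub> (a i) \<subseteq> PIdl\<^bsub>R\<^esub> (a j) then 1 else 0)"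

definition D_mat :: "('a, 'm) ring_scheme \<Rightarrow> nat \<Rightarrow> (nat \<Rightarrow> 'a) \<Rightarrow> rat mat" where
  "D_mat R t a = mat_diag (t + 1) (\<lambda>i. of_nat (card (PIdl\<^bsub>R\<^esub> (a i))))"

definition Q_mat :: "('a, 'm) ring_scheme \<Rightarrow> nat \<Rightarrow> (nat \<Rightarrow> 'a) \<Rightarrow> rat mat" where
  "Q_mat R t a =
    mat (t + 1) (t + 1) (\<lambda>(i, j). if PIdl\<^bsub>R\<^esub> (a j) \<subseteq> annihilator R (a i) then 1 else 0)"

end

theory Submission
  imports
    Defs
    "Jordan_Normal_Form.Determinant"
begin

text \<open>
  Substituting \<open>x = Ay\<close> and expanding the product over the positions, the coefficients on the two
  sides count, for each \<open>J : [n] \<rightarrow> {0, \<dots>, t}\<close>, the words of \<open>C\<^sup>\<bottom>\<close> lying in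
  \<open>P = \<Prod>\<^sub>l a\<^bsub>J l\<^esub>R\<close> and the words of \<open>C\<close> lying in \<open>P\<^sup>\<bottom>\<close>. Thus everything reduces to
  \<open>|C| |C\<^sup>\<bottom> \<inter> P| = |P| |C \<inter> P\<^sup>\<bottom>|\<close>. Writing the elements of \<open>P\<close> as \<open>bw\<close>, this follows from
  \<open>|B| |B\<^sup>\<bottom>| = |R|\<^sup>n\<close> for the code \<open>B = bC\<close>. The latter is proved without characters, by
  projecting to one coordinate: the image is an ideal \<open>aR\<close>, and \<open>(aR)\<^sup>\<bottom>\<^sup>\<bottom> = aR\<close>.
\<close>

section \<open>Counting along fibres\<close>

text \<open>First isomorphism theorem in counting form: an injective self-map
  \<open>\<tau> y\<close> of the finite set \<open>G\<close> permutes it and carries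
  \<open>K\<close> onto the fibre of \<open>f\<close> through \<open>y\<close>, so all fibres have
  the size of \<open>K\<close>. Working with translations \<open>\<tau> y\<close> serves ring
  elements and words alike, without quotient groups.\<close>

lemma card_by_fibres:
  assumes fin: "finite G"
    and inj: "\<And>y. y \<in> G \<Longrightarrow> inj_on (\<tau> y) G"
    and closed: "\<And>x y. x \<in> G \<Longrightarrow> y \<in> G \<Longrightarrow> \<tau> y x \<in> G"
    and fibre: "\<And>x y. x \<in> G \<Longrightarrow> y \<in> G \<Longrightarrow> f (\<tau> y x) = f y \<longleftrightarrow> x \<in> K"
    and "K \<subseteq> G"
  shows "card G = card (f ` G) * card K"
proof -
  have "card {x \<in> G. f x = z} = card K" if z: "z \<in> f ` G" for z
  proof -
    obtain y where y: "y \<in> G" "z = f y" using z by blast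
    have "\<tau> y ` G = G"
      using fin inj[OF y(1)] closed y(1) by (intro endo_inj_surj) auto
    then have "{x \<in> G. f x = z} = {x \<in> \<tau> y ` G. f x = f y}"
      using y(2) by simp
    also have "\<dots> = \<tau> y ` {x \<in> G. f (\<tau> y x) = f y}" by auto
    also have "{x \<in> G. f (\<tau> y x) = f y} = {x \<in> G. x \<in> K}"
      using fibre y(1) by (intro Collect_cong conj_cong refl) auto
    also have "\<dots> = K" using \<open>K \<subseteq> G\<close> by auto
    finally have "{x \<in> G. f x = z} = \<tau> y ` K" .
    then show ?thesis
      using inj[OF y(1)] \<open>K \<subseteq> G\<close> by (simp add: card_image inj_on_subset)
  qed
  then have "(\<Sum>z\<in>f ` G. card {x \<in> G. f x = z}) = card (f ` G) * card K" by simp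
  then show ?thesis
    using sum.image_gen[OF fin, of "\<lambda>_. 1::nat" f] by simp
qed

section \<open>Codes, the inner product and ideals over a commutative ring\<close>

context cring
begin

text \<open>The index set is arbitrary here and in the next two definitions, because
  \<open>card_dual_on\<close> is proved by induction on the set of coordinates, adding one with
  \<open>insert\<close>.\<close>

definition dot :: "'i set \<Rightarrow> ('i \<Rightarrow> 'a) \<Rightarrow> ('i \<Rightarrow> 'a) \<Rightarrow> 'a" where
  "dot I u v = (\<Oplus>l\<in>I. u l \<otimes> v l)"

definition linear_on :: "'i set \<Rightarrow> ('i \<Rightarrow> 'a) set \<Rightarrow> bool" where
  "linear_on I C \<longleftrightarrow>
    C \<subseteq> I \<rightarrow>\<^sub>E carrier R \<and> (\<lambda>l\<in>I. \<zero>) \<in> C \<and>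
    (\<forall>u\<in>C. \<forall>v\<in>C. (\<lambda>l\<in>I. u l \<oplus> v l) \<in> C) \<and>
    (\<forall>r\<in>carrier R. \<forall>v\<in>C. (\<lambda>l\<in>I. r \<otimes> v l) \<in> C)"

definition dual_on :: "'i set \<Rightarrow> ('i \<Rightarrow> 'a) set \<Rightarrow> ('i \<Rightarrow> 'a) set" where
  "dual_on I C = {v \<in> I \<rightarrow>\<^sub>E carrier R. \<forall>u\<in>C. dot I u v = \<zero>}"

lemma
  assumes "linear_on I C"
  shows linear_on_carrier: "u \<in> C \<Longrightarrow> u \<in> I \<rightarrow>\<^sub>E carrier R"
    and linear_on_closed: "u \<in> C \<Longrightarrow> l \<in> I \<Longrightarrow> u l \<in> carrier R"
    and linear_on_zero: "(\<lambda>l\<in>I. \<zero>) \<in> C"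
    and linear_on_add: "u \<in> C \<Longrightarrow> v \<in> C \<Longrightarrow> (\<lambda>l\<in>I. u l \<oplus> v l) \<in> C"
    and linear_on_smult: "r \<in> carrier R \<Longrightarrow> v \<in> C \<Longrightarrow> (\<lambda>l\<in>I. r \<otimes> v l) \<in> C"
  using assms unfolding linear_on_def by (blast, fastforce, blast+)

text \<open>Products are compared rather than factors, so that the two words may be exchanged and a
  scalar may pass from one word to the other.\<close>

lemma dot_cong:
  assumes "\<And>l. l \<in> I \<Longrightarrow> u l \<otimes> v l = u' l \<otimes> v' l"
    and "\<And>l. l \<in> I \<Longrightarrow> u' l \<otimes> v' l \<in> carrier R"
  shows "dot I u v = dot I u' v'"
  unfolding dot_def using assms by (intro finsum_cong') auto

lemma dot_closed:
  assumes "u \<in> I \<rightarrow> carrier R" "v \<in> I \<rightarrow> carrier R"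
  shows "dot I u v \<in> carrier R"
  unfolding dot_def using assms by (intro finsum_closed) auto

lemma dot_zero_right: "u \<in> I \<rightarrow> carrier R \<Longrightarrow> dot I u (\<lambda>l\<in>I. \<zero>) = \<zero>"
  unfolding dot_def by (intro add.finprod_one_eqI) (auto simp: Pi_iff)

text \<open>Linearity is proved for the right argument only; symmetry transfers it to the left
  one.\<close>

lemma dot_commute:
  assumes "u \<in> I \<rightarrow> carrier R" "v \<in> I \<rightarrow> carrier R"
  shows "dot I u v = dot I v u"
  using assms by (intro dot_cong) (auto simp: Pi_iff m_comm)

lemma dot_add_right:
  assumes "u \<in> I \<rightarrow> carrier R" "v \<in> I \<rightarrow> carrier R" "w \<in> I \<rightarrow> carrier R"
  shows "dot I u (\<lambda>l\<in>I. v l \<oplus> w l) = dot I u v \<oplus> dot I u w"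
proof -
  have "dot I u (\<lambda>l\<in>I. v l \<oplus> w l) = (\<Oplus>l\<in>I. u l \<otimes> v l \<oplus> u l \<otimes> w l)"
    unfolding dot_def using assms by (intro finsum_cong') (auto simp: Pi_iff r_distr)
  also have "\<dots> = dot I u v \<oplus> dot I u w"
    unfolding dot_def using assms by (intro finsum_addf) auto
  finally show ?thesis .
qed

lemma dot_smult_right:
  assumes "finite I" "r \<in> carrier R" "u \<in> I \<rightarrow> carrier R" "v \<in> I \<rightarrow> carrier R"
  shows "dot I u (\<lambda>l\<in>I. r \<otimes> v l) = r \<otimes> dot I u v"
proof -
  have "dot I u (\<lambda>l\<in>I. r \<otimes> v l) = (\<Oplus>l\<in>I. r \<otimes> (u l \<otimes> v l))"
    unfolding dot_def using assms by (intro finsum_cong') (auto simp: Pi_iff m_lcomm)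
  also have "\<dots> = r \<otimes> dot I u v"
    unfolding dot_def using assms by (intro finsum_rdistr[symmetric]) auto
  finally show ?thesis .
qed

lemma dot_insert:
  assumes "finite I" "i \<notin> I" "u \<in> insert i I \<rightarrow> carrier R" "v \<in> insert i I \<rightarrow> carrier R"
  shows "dot (insert i I) u v = u i \<otimes> v i \<oplus> dot I u v"
  unfolding dot_def using assms by (intro finsum_insert) (auto simp: Pi_iff)

lemma PiE_imp_funcset: "v \<in> I \<rightarrow>\<^sub>E carrier R \<Longrightarrow> v \<in> I \<rightarrow> carrier R"
  by auto

text \<open>Fibres of additive maps are counted on the dual as well, so it has to be a code itself.
  Closure follows from linearity of \<open>dot\<close> in its right argument.\<close>

lemma linear_on_dual_on:
  assumes "finite I" "linear_on I C"
  shows "linear_on I (dual_on I C)"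
proof -
  have u: "u \<in> I \<rightarrow> carrier R" if "u \<in> C" for u
    using linear_on_carrier[OF assms(2) that] by (rule PiE_imp_funcset)
  show ?thesis
    unfolding linear_on_def dual_on_def
  proof (intro conjI ballI CollectI subsetI; (elim CollectE conjE)?)
    fix v w x assume "v \<in> I \<rightarrow>\<^sub>E carrier R" "w \<in> I \<rightarrow>\<^sub>E carrier R"
      "\<forall>u\<in>C. dot I u v = \<zero>" "\<forall>u\<in>C. dot I u w = \<zero>" "x \<in> C"
    then show "dot I x (\<lambda>l\<in>I. v l \<oplus> w l) = \<zero>"
      using u by (simp add: dot_add_right PiE_imp_funcset)
  next
    fix r v x assume "r \<in> carrier R" "v \<in> I \<rightarrow>\<^sub>E carrier R"
      "\<forall>u\<in>C. dot I u v = \<zero>" "x \<in> C"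
    then show "dot I x (\<lambda>l\<in>I. r \<otimes> v l) = \<zero>"
      using u assms(1) by (simp add: dot_smult_right PiE_imp_funcset)
  qed (auto simp: u dot_zero_right)
qed

lemma inj_on_translation:
  assumes "linear_on I G" "y \<in> G"
  shows "inj_on (\<lambda>x. \<lambda>l\<in>I. y l \<oplus> x l) G"
proof (rule inj_onI)
  fix u v assume uv: "u \<in> G" "v \<in> G" "(\<lambda>l\<in>I. y l \<oplus> u l) = (\<lambda>l\<in>I. y l \<oplus> v l)"
  show "u = v"
  proof (rule PiE_ext)
    show "u \<in> I \<rightarrow>\<^sub>E carrier R" "v \<in> I \<rightarrow>\<^sub>E carrier R"
      using linear_on_carrier[OF assms(1)] uv by auto
    fix l assume l: "l \<in> I"
    then have "y l \<oplus> u l = y l \<oplus> v l"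
      using fun_cong[OF uv(3), of l] by simp
    then show "u l = v l"
      using linear_on_closed[OF assms(1)] assms(2) uv(1,2) l by simp
  qed
qed

lemma mem_cgenideal_iff: "x \<in> PIdl a \<longleftrightarrow> (\<exists>r\<in>carrier R. x = r \<otimes> a)"
  by (auto simp: cgenideal_def)

lemma ideal_annihilator:
  assumes "a \<in> carrier R"
  shows "ideal (annihilator R a) R"
proof (rule idealI)
  show "subgroup (annihilator R a) (add_monoid R)"
    by (rule subgroup.intro)
      (use assms in \<open>auto simp: annihilator_def r_distr r_minus simp flip: a_inv_def\<close>)
next
  fix x r assume "x \<in> annihilator R a" and r: "r \<in> carrier R"
  then have x: "x \<in> carrier R" "a \<otimes> x = \<zero>" by (auto simp: annihilator_def)
  then show "r \<otimes> x \<in> annihilator R a"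
    using assms r m_lcomm[of a r x] by (simp add: annihilator_def)
  then show "x \<otimes> r \<in> annihilator R a"
    using x r by (simp add: m_comm)
qed (rule ring_axioms)

lemma cgenideal_subset_iff:
  assumes "a \<in> carrier R" "ideal J R"
  shows "PIdl a \<subseteq> J \<longleftrightarrow> a \<in> J"
  using assms cgenideal_minimal cgenideal_self by blast

lemma annihilator_commute:
  assumes "a \<in> carrier R" "b \<in> carrier R"
  shows "a \<in> annihilator R b \<longleftrightarrow> b \<in> annihilator R a"
  using assms by (auto simp: annihilator_def m_comm)

text \<open>The sum of principal ideals is the least ideal containing all generators. This splits a
  condition on the ideal generated by one coordinate of a tuple of words into a separate condition
  on each word.\<close>

lemma ideal_sum_subset_iff:
  assumes "finite M" "\<And>m. m \<in> M \<Longrightarrow> f m \<in> carrier R" "ideal J R"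
  shows "ideal_sum R M (\<lambda>m. PIdl (f m)) \<subseteq> J \<longleftrightarrow> (\<forall>m\<in>M. f m \<in> J)"
proof
  interpret J: ideal J R by fact
  { assume J: "ideal_sum R M (\<lambda>m. PIdl (f m)) \<subseteq> J"
    show "\<forall>m\<in>M. f m \<in> J"
    proof
      fix m assume m: "m \<in> M"
      \<comment> \<open>The family concentrated at \<open>m\<close>, whose sum is
        \<open>f m\<close>.\<close>
      let ?g = "\<lambda>m'. if m = m' then f m' else \<zero>"
      have "?g \<in> (\<Pi> m\<in>M. PIdl (f m))"
        using assms(2) cgenideal_self
          additive_subgroup.zero_closed[OF ideal.axioms(1)[OF cgenideal_ideal]] by simp
      then have "(\<Oplus>m'\<in>M. ?g m') \<in> J" using J by (auto simp: ideal_sum_def)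
      moreover have "(\<Oplus>m'\<in>M. ?g m') = f m"
        using m assms by (intro add.finprod_singleton) auto
      ultimately show "f m \<in> J" by simp
    qed }
  assume f: "\<forall>m\<in>M. f m \<in> J"
  show "ideal_sum R M (\<lambda>m. PIdl (f m)) \<subseteq> J"
  proof
    fix x assume "x \<in> ideal_sum R M (\<lambda>m. PIdl (f m))"
    then obtain g where g: "x = (\<Oplus>m\<in>M. g m)" "g \<in> (\<Pi> m\<in>M. PIdl (f m))"
      by (auto simp: ideal_sum_def)
    have "g \<in> M \<rightarrow> J"
      using g(2) f cgenideal_minimal[OF assms(3)] by blast
    with assms(1) have "finsum R g M \<in> J"
    proof (induction M rule: finite_induct)
      case (insert m M)
      then show ?case
        by (subst finsum_insert) (auto intro: J.Icarr J.a_closed)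
    qed (simp add: J.zero_closed)
    then show "x \<in> J" using g(1) by simp
  qed
qed

text \<open>Makes principality available for the ideals that occur in
  \<open>ideal_positions\<close>. Negatives come from multiplication by
  \<open>\<ominus> \<one>\<close>.\<close>

lemma ideal_ideal_sum:
  assumes "finite M" "\<And>m. m \<in> M \<Longrightarrow> f m \<in> carrier R"
  shows "ideal (ideal_sum R M (\<lambda>m. PIdl (f m))) R"
proof -
  let ?F = "\<Pi> m\<in>M. PIdl (f m)"
  have id: "ideal (PIdl (f m)) R" if "m \<in> M" for m
    using cgenideal_ideal[OF assms(2)[OF that]] .
  have F: "g m \<in> carrier R" if "g \<in> ?F" "m \<in> M" for g m
    using that ideal.Icarr[OF id] by blast
  have S: "finsum R g M \<in> ideal_sum R M (\<lambda>m. PIdl (f m))" if "g \<in> ?F" for g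
    using that by (auto simp: ideal_sum_def)
  have smult: "r \<otimes> x \<in> ideal_sum R M (\<lambda>m. PIdl (f m))"
    if r: "r \<in> carrier R" and x: "x \<in> ideal_sum R M (\<lambda>m. PIdl (f m))" for r x
  proof -
    obtain g where g: "x = finsum R g M" "g \<in> ?F"
      using x by (auto simp: ideal_sum_def)
    have "r \<otimes> x = (\<Oplus>m\<in>M. r \<otimes> g m)"
      unfolding g(1) using assms r F[OF g(2)] by (intro finsum_rdistr) auto
    then show ?thesis
      using g(2) id r by (auto intro!: S ideal.I_l_closed)
  qed
  have carr: "x \<in> carrier R" if "x \<in> ideal_sum R M (\<lambda>m. PIdl (f m))" for x
    using that F by (auto simp: ideal_sum_def intro!: finsum_closed)
  show ?thesis
  proof (rule idealI)
    show "subgroup (ideal_sum R M (\<lambda>m. PIdl (f m))) (add_monoid R)"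
    proof (rule add.subgroupI)
      show "ideal_sum R M (\<lambda>m. PIdl (f m)) \<noteq> {}"
        using S[of f] assms(2) by (auto simp: cgenideal_self)
    next
      fix x assume x: "x \<in> ideal_sum R M (\<lambda>m. PIdl (f m))"
      have "\<ominus> \<one> \<otimes> x = \<ominus> x" using carr[OF x] by (simp add: l_minus)
      then show "\<ominus> x \<in> ideal_sum R M (\<lambda>m. PIdl (f m))"
        using smult[OF _ x, of "\<ominus> \<one>"] by simp
    next
      fix x y assume "x \<in> ideal_sum R M (\<lambda>m. PIdl (f m))" "y \<in> ideal_sum R M (\<lambda>m. PIdl (f m))"
      then obtain g h where gh: "x = finsum R g M" "g \<in> ?F" "y = finsum R h M" "h \<in> ?F"
        by (auto simp: ideal_sum_def)
      have "x \<oplus> y = (\<Oplus>m\<in>M. g m \<oplus> h m)"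
        unfolding gh using F gh by (intro finsum_addf[symmetric]) auto
      then show "x \<oplus> y \<in> ideal_sum R M (\<lambda>m. PIdl (f m))"
        using gh id by (auto intro!: S additive_subgroup.a_closed ideal.axioms(1))
    qed (use carr in auto)
  next
    fix x r assume x: "x \<in> ideal_sum R M (\<lambda>m. PIdl (f m))" and r: "r \<in> carrier R"
    then show "r \<otimes> x \<in> ideal_sum R M (\<lambda>m. PIdl (f m))" by (intro smult)
    then show "x \<otimes> r \<in> ideal_sum R M (\<lambda>m. PIdl (f m))"
      using carr[OF x] r by (simp add: m_comm)
  qed (rule ring_axioms)
qed

end

section \<open>Cardinalities of annihilators and dual codes\<close>

context finite_principal_ideal_ring
begin

lemma finite_linear_on:
  assumes "finite I" "linear_on I C"
  shows "finite C"
  using assms finite_carrier linear_on_carrier[OF assms(2)]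
  by (meson finite_PiE finite_subset subsetI)

text \<open>Fibre counting for additive maps on codes, with \<open>K\<close> as kernel. It is
  applied to a coordinate, to a restriction and to a coordinatewise multiple.\<close>

lemma card_linear_on_image:
  assumes "finite I" "linear_on I G" "K \<subseteq> G"
    and "\<And>x y. x \<in> G \<Longrightarrow> y \<in> G \<Longrightarrow> f (\<lambda>l\<in>I. y l \<oplus> x l) = f y \<longleftrightarrow> x \<in> K"
  shows "card G = card (f ` G) * card K"
  using assms
  by (intro card_by_fibres[where \<tau> = "\<lambda>y x. \<lambda>l\<in>I. y l \<oplus> x l"])
    (auto intro: finite_linear_on inj_on_translation linear_on_add)

text \<open>Multiplication by \<open>a\<close> on the ring has image \<open>aR\<close> and kernel
  the annihilator of \<open>a\<close>.\<close>

lemma card_cgenideal_annihilator: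
  assumes "a \<in> carrier R"
  shows "card (PIdl a) * card (annihilator R a) = card (carrier R)"
proof -
  have "card (carrier R) = card ((\<lambda>r. a \<otimes> r) ` carrier R) * card (annihilator R a)"
    by (rule card_by_fibres[where \<tau> = "\<lambda>y x. y \<oplus> x"])
      (use assms in \<open>auto simp: finite_carrier annihilator_def r_distr inj_on_def\<close>)
  moreover have "(\<lambda>r. a \<otimes> r) ` carrier R = PIdl a"
    using assms m_comm by (auto simp: cgenideal_def)
  ultimately show ?thesis by simp
qed

lemma finite_annihilator: "finite (annihilator R a)"
  using finite_carrier by (simp add: annihilator_def)

lemma card_annihilator_pos: "a \<in> carrier R \<Longrightarrow> card (annihilator R a) > 0"
  using finite_annihilator by (auto simp: card_gt_0_iff annihilator_def intro!: exI[of _ \<zero>])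

text \<open>With \<open>(aR)\<^sup>\<bottom> = dR\<close>, both \<open>aR\<close> and \<open>(dR)\<^sup>\<bottom>\<close> have \<open>|R| / |dR|\<close> elements.\<close>

lemma double_annihilator:
  assumes a: "a \<in> carrier R" and x: "x \<in> carrier R"
    and ann: "\<And>s. s \<in> annihilator R a \<Longrightarrow> s \<otimes> x = \<zero>"
  shows "x \<in> PIdl a"
proof -
  obtain d where d: "d \<in> carrier R" "annihilator R a = PIdl d"
    using ideal_principal[OF ideal_annihilator[OF a]] by blast
  have dann: "d \<in> annihilator R a" using d cgenideal_self by auto
  then have "PIdl a \<subseteq> annihilator R d"
    using a d(1) by (simp add: cgenideal_subset_iff ideal_annihilator annihilator_commute)
  moreover have "card (PIdl a) = card (annihilator R d)"
    using card_cgenideal_annihilator[OF a] card_cgenideal_annihilator[OF d(1)]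
      card_annihilator_pos[OF a] d(2) by (metis mult.commute mult_right_cancel less_not_refl)
  ultimately have "PIdl a = annihilator R d"
    using finite_annihilator by (intro card_subset_eq) auto
  then show ?thesis using ann[OF dann] x by (simp add: annihilator_def)
qed

text \<open>Induction on the coordinates. The entries of \<open>C\<close> at the new coordinate
  \<open>i\<close> form an ideal \<open>aR\<close>, and the words with entry zero there give a code
  \<open>C'\<close> on \<open>I\<close>. Restriction to \<open>I\<close> maps the dual of
  \<open>C\<close> onto the dual of \<open>C'\<close>, and its kernel is as large as the annihilator
  of \<open>a\<close>. The coordinate \<open>i\<close> thus contributes the factor
  \<open>|aR|\<close> to \<open>C\<close> and the factor \<open>|ann a|\<close> to the dual,
  together \<open>|R|\<close>.\<close>

lemma card_dual_on:
  assumes "finite I" "linear_on I C"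
  shows "card C * card (dual_on I C) = card (carrier R) ^ card I"
  using assms
proof (induction I arbitrary: C rule: finite_induct)
  case empty
  then have "C = {\<lambda>l. undefined}"
    by (auto simp: linear_on_def)
  moreover have "dual_on {} C = {\<lambda>l. undefined}"
    by (auto simp: dual_on_def dot_def)
  ultimately show ?case by simp
next
  case (insert i I C)
  note lin = linear_on_closed[OF insert.prems] linear_on_zero[OF insert.prems]
    linear_on_add[OF insert.prems] linear_on_smult[OF insert.prems]
  have fin: "finite (insert i I)" using insert by simp
  have linD: "linear_on (insert i I) (dual_on (insert i I) C)"
    using linear_on_dual_on[OF fin insert.prems] .
  have "ideal ((\<lambda>u. u i) ` C) R"
  proof (rule idealI)
    show "subgroup ((\<lambda>u. u i) ` C) (add_monoid R)"
    proof (rule add.subgroupI)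
      fix x assume "x \<in> (\<lambda>u. u i) ` C"
      then obtain u where u: "u \<in> C" "x = u i" by blast
      have "\<ominus> \<one> \<otimes> x = \<ominus> x" using lin(1) u by (simp add: l_minus)
      then show "\<ominus> x \<in> (\<lambda>u. u i) ` C"
        using lin(4)[OF _ u(1), of "\<ominus> \<one>"] u(2) by (intro image_eqI) auto
    next
      fix x y assume "x \<in> (\<lambda>u. u i) ` C" "y \<in> (\<lambda>u. u i) ` C"
      then obtain u v where uv: "u \<in> C" "x = u i" "v \<in> C" "y = v i" by blast
      show "x \<oplus> y \<in> (\<lambda>u. u i) ` C"
        using lin(3)[OF uv(1,3)] uv by (intro image_eqI) auto
    qed (use lin in auto)
  next
    fix x r assume "x \<in> (\<lambda>u. u i) ` C" and r: "r \<in> carrier R"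
    then obtain u where u: "u \<in> C" "x = u i" by blast
    show "r \<otimes> x \<in> (\<lambda>u. u i) ` C"
      using lin(4)[OF r u(1)] u by (intro image_eqI) auto
    then show "x \<otimes> r \<in> (\<lambda>u. u i) ` C"
      using r u lin(1) by (simp add: m_comm)
  qed (rule ring_axioms)
  then obtain a where a: "a \<in> carrier R" "(\<lambda>u. u i) ` C = PIdl a"
    using ideal_principal by blast
  then obtain g where g: "g \<in> C" "g i = a"
    using cgenideal_self by (metis imageE)
  \<comment> \<open>\<open>C'\<close> is the code \<open>C\<close> shortened at \<open>i\<close>.
    Deleting the coordinate loses nothing on \<open>C0\<close>, where it is zero.\<close>
  define C0 where "C0 = {u \<in> C. u i = \<zero>}"
  define C' where "C' = (\<lambda>u. restrict u I) ` C0"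
  have C0: "u \<in> C" "u i = \<zero>" if "u \<in> C0" for u using that by (auto simp: C0_def)
  have "inj_on (\<lambda>u. restrict u I) C0"
  proof (rule inj_onI)
    fix u v assume uv: "u \<in> C0" "v \<in> C0" "restrict u I = restrict v I"
    show "u = v"
    proof (rule PiE_ext)
      show "u \<in> insert i I \<rightarrow>\<^sub>E carrier R" "v \<in> insert i I \<rightarrow>\<^sub>E carrier R"
        using uv C0 linear_on_carrier[OF insert.prems] by blast+
      fix l assume "l \<in> insert i I"
      then show "u l = v l"
        using C0(2)[OF uv(1)] C0(2)[OF uv(2)] fun_cong[OF uv(3), of l] by (cases "l = i") auto
    qed
  qed
  then have card_C': "card C' = card C0" by (simp add: C'_def card_image)
  have linC': "linear_on I C'"
    unfolding linear_on_def
  proof (intro conjI ballI subsetI)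
    have z: "(\<lambda>l\<in>insert i I. \<zero>) \<in> C0" using lin by (simp add: C0_def)
    show "(\<lambda>l\<in>I. \<zero>) \<in> C'"
      unfolding C'_def by (rule image_eqI[OF _ z]) auto
  next
    fix u assume "u \<in> C'"
    then show "u \<in> I \<rightarrow>\<^sub>E carrier R"
      using C0 lin(1) by (auto simp: C'_def)
  next
    fix u v assume "u \<in> C'" "v \<in> C'"
    then obtain u0 v0 where uv: "u0 \<in> C0" "u = restrict u0 I" "v0 \<in> C0" "v = restrict v0 I"
      by (auto simp: C'_def)
    then have z: "(\<lambda>l\<in>insert i I. u0 l \<oplus> v0 l) \<in> C0"
      using lin by (simp add: C0_def)
    show "(\<lambda>l\<in>I. u l \<oplus> v l) \<in> C'"
      unfolding C'_def by (rule image_eqI[OF _ z]) (auto simp: uv)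
  next
    fix r v assume r: "r \<in> carrier R" and "v \<in> C'"
    then obtain v0 where v: "v0 \<in> C0" "v = restrict v0 I"
      by (auto simp: C'_def)
    then have z: "(\<lambda>l\<in>insert i I. r \<otimes> v0 l) \<in> C0"
      using lin r by (simp add: C0_def)
    show "(\<lambda>l\<in>I. r \<otimes> v l) \<in> C'"
      unfolding C'_def by (rule image_eqI[OF _ z]) (auto simp: v)
  qed
  have C: "card C = card (PIdl a) * card C0"
    unfolding a(2)[symmetric]
    by (rule card_linear_on_image[OF fin insert.prems])
      (use lin in \<open>auto simp: C0_def\<close>)

  let ?D = "dual_on (insert i I) C"
  \<comment> \<open>The kernel of restriction to \<open>I\<close>: dual words supported at
    \<open>i\<close>.\<close>
  let ?K = "{v \<in> ?D. \<forall>l\<in>I. v l = \<zero>}"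
  have Dcarr: "v l \<in> carrier R" if "v \<in> ?D" "l \<in> insert i I" for v l
    using linear_on_closed[OF linD] that by blast
  have gcarr: "g \<in> insert i I \<rightarrow> carrier R" using lin(1) g(1) by auto
  have dot_C0: "dot (insert i I) u v = dot I (restrict u I) (restrict v I)"
    if "u \<in> C0" "v \<in> insert i I \<rightarrow> carrier R" for u v
  proof -
    have "dot I u v = dot I (restrict u I) (restrict v I)"
      using that C0 lin(1) by (intro dot_cong) auto
    moreover have "dot I u v \<in> carrier R"
      using that C0 lin(1) by (intro dot_closed) auto
    ultimately show ?thesis
      using that C0[OF that(1)] lin(1) insert.hyps
      by (subst dot_insert) (auto simp: Pi_iff simp del: restrict_apply)
  qed
  text \<open>As \<open>C = C0 + gR\<close>, orthogonality to \<open>C\<close> need only be tested on \<open>C0\<close> and \<open>g\<close>.\<close>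
  have dual_iff: "v \<in> ?D \<longleftrightarrow>
      restrict v I \<in> dual_on I C' \<and> a \<otimes> v i \<oplus> dot I g v = \<zero>"
    if v: "v \<in> insert i I \<rightarrow>\<^sub>E carrier R" for v
  proof -
    have vc: "v \<in> insert i I \<rightarrow> carrier R" using v by auto
    have 1: "dot (insert i I) g v = a \<otimes> v i \<oplus> dot I g v"
      using insert.hyps gcarr vc g(2) by (simp add: dot_insert)
    have 2: "restrict v I \<in> dual_on I C' \<longleftrightarrow> (\<forall>u\<in>C0. dot (insert i I) u v = \<zero>)"
      using vc by (auto simp: dual_on_def C'_def dot_C0)
    have 3: "dot (insert i I) u v = \<zero>"
      if u: "u \<in> C" and all: "\<forall>u\<in>C0. dot (insert i I) u v = \<zero>"
        and gv: "dot (insert i I) g v = \<zero>" for u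
    proof -
      have "u i \<in> PIdl a" using u a(2) by blast
      then obtain r where r: "r \<in> carrier R" "u i = r \<otimes> a"
        by (auto simp: mem_cgenideal_iff)
      let ?rg = "\<lambda>s. \<lambda>l\<in>insert i I. s \<otimes> g l"
      \<comment> \<open>This is \<open>u - rg\<close>. It vanishes at \<open>i\<close> because
        \<open>u i = ra\<close> and \<open>g i = a\<close>, so it belongs to
        \<open>C0\<close>.\<close>
      let ?w = "\<lambda>l\<in>insert i I. u l \<oplus> ?rg (\<ominus> r) l"
      have mr: "\<ominus> r \<in> carrier R" using r by simp
      have wC: "?w \<in> C" using lin(3)[OF u lin(4)[OF mr g(1)]] .
      then have w: "?w \<in> C0"
        using r g a by (simp add: C0_def l_minus r_neg)
      have cc: "u \<in> insert i I \<rightarrow> carrier R" "?rg (\<ominus> r) \<in> insert i I \<rightarrow> carrier R"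
        "?w \<in> insert i I \<rightarrow> carrier R"
        using lin(1) u g mr by auto
      have "\<zero> = dot (insert i I) v ?w"
        using all w vc cc dot_commute[OF vc cc(3)] by simp
      also have "\<dots> = dot (insert i I) v u \<oplus> dot (insert i I) v (?rg (\<ominus> r))"
        using vc cc by (intro dot_add_right)
      also have "dot (insert i I) v (?rg (\<ominus> r)) = \<zero>"
        using vc gcarr mr gv fin dot_commute[OF vc gcarr] by (simp add: dot_smult_right)
      finally show ?thesis
        using vc cc dot_closed[OF vc cc(1)] dot_commute[OF vc cc(1)] by simp
    qed
    have "v \<in> ?D \<longleftrightarrow> (\<forall>u\<in>C. dot (insert i I) u v = \<zero>)"
      using v by (simp add: dual_on_def)
    also have "\<dots> \<longleftrightarrow> (\<forall>u\<in>C0. dot (insert i I) u v = \<zero>) \<and> dot (insert i I) g v = \<zero>"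
      using 3 g(1) C0(1) by blast
    finally show ?thesis using 1 2 by simp
  qed
  have image: "(\<lambda>v. restrict v I) ` ?D = dual_on I C'"
  proof (intro equalityI subsetI)
    fix v assume "v \<in> (\<lambda>v. restrict v I) ` ?D"
    then show "v \<in> dual_on I C'"
      using dual_iff linear_on_carrier[OF linD] by blast
  next
    \<comment> \<open>Surjectivity: extending \<open>v\<close> to \<open>i\<close> means solving
      \<open>a x = - dot I g v\<close> for the new entry \<open>x\<close>, which requires
      \<open>dot I g v\<close> to lie in \<open>aR\<close>. By \<open>double_annihilator\<close> it
      suffices that every \<open>s\<close> annihilating \<open>a\<close> also annihilates
      \<open>dot I g v\<close>. Indeed \<open>sg\<close> has entry \<open>sa = 0\<close> at
      \<open>i\<close>, so its restriction lies in \<open>C'\<close> and is orthogonal to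
      \<open>v\<close>.\<close>
    fix v assume v: "v \<in> dual_on I C'"
    then have vE: "v \<in> I \<rightarrow>\<^sub>E carrier R" by (simp add: dual_on_def)
    then have vc: "v \<in> I \<rightarrow> carrier R" by auto
    have gI: "g \<in> I \<rightarrow> carrier R" using gcarr by auto
    have gv: "dot I g v \<in> carrier R" using gI vc by (rule dot_closed)
    have "s \<otimes> dot I g v = \<zero>" if s: "s \<in> annihilator R a" for s
    proof -
      have sc: "s \<in> carrier R" "a \<otimes> s = \<zero>" using s by (auto simp: annihilator_def)
      let ?sg = "\<lambda>l\<in>insert i I. s \<otimes> g l"
      have "?sg \<in> C0"
        using lin(4)[OF sc(1) g(1)] sc g a(1) by (simp add: C0_def m_comm)
      then have "restrict ?sg I \<in> C'" unfolding C'_def by (rule imageI)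
      moreover have "restrict ?sg I = (\<lambda>l\<in>I. s \<otimes> g l)" by auto
      ultimately have "dot I (\<lambda>l\<in>I. s \<otimes> g l) v = \<zero>"
        using v by (auto simp: dual_on_def)
      moreover have "dot I (\<lambda>l\<in>I. s \<otimes> g l) v = s \<otimes> dot I g v"
      proof -
        have "(\<lambda>l\<in>I. s \<otimes> g l) \<in> I \<rightarrow> carrier R" using sc gI by auto
        then have "dot I (\<lambda>l\<in>I. s \<otimes> g l) v = dot I v (\<lambda>l\<in>I. s \<otimes> g l)"
          using vc by (intro dot_commute)
        also have "\<dots> = s \<otimes> dot I g v"
          using vc gI sc insert.hyps dot_commute[OF vc gI] by (simp add: dot_smult_right)
        finally show ?thesis .
      qed
      ultimately show ?thesis by simp
    qed
    then have "dot I g v \<in> PIdl a" using a(1) gv by (intro double_annihilator)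
    then obtain r where r: "r \<in> carrier R" "dot I g v = r \<otimes> a"
      by (auto simp: mem_cgenideal_iff)
    \<comment> \<open>The entry \<open>- r\<close> cancels \<open>dot I g v = ra\<close>.\<close>
    let ?v = "v(i := \<ominus> r)"
    have vi: "?v \<in> insert i I \<rightarrow>\<^sub>E carrier R"
      using vE r(1) by (intro PiE_fun_upd) auto
    have res: "restrict ?v I = v"
      using vE insert.hyps by (intro ext) (auto simp: PiE_def extensional_def)
    have "dot I g ?v = dot I g v"
      using gI vc insert.hyps by (intro dot_cong) (auto simp: Pi_iff)
    then have "a \<otimes> ?v i \<oplus> dot I g ?v = \<zero>"
      using r a(1) by (simp add: r_minus m_comm l_neg)
    then have "?v \<in> ?D" using dual_iff[OF vi] v res by simp
    then show "v \<in> (\<lambda>v. restrict v I) ` ?D" using res by (metis imageI)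
  qed
  have D: "card ?D = card (dual_on I C') * card ?K"
    unfolding image[symmetric]
  proof (rule card_linear_on_image[OF fin linD])
    fix x y assume x: "x \<in> ?D" and y: "y \<in> ?D"
    have "y l \<oplus> x l = y l \<longleftrightarrow> x l = \<zero>" if "l \<in> I" for l
      using Dcarr[OF x, of l] Dcarr[OF y, of l] that by auto
    then show "restrict (\<lambda>l\<in>insert i I. y l \<oplus> x l) I = restrict y I \<longleftrightarrow> x \<in> ?K"
      using x by (auto simp: fun_eq_iff restrict_def)
  qed auto
  \<comment> \<open>For a word supported at \<open>i\<close>, orthogonality to \<open>C\<close>
    reduces to \<open>a v\<^sub>i = 0\<close>, so its entry there ranges over the whole annihilator
    of \<open>a\<close>.\<close>
  have K: "card ?K = card (annihilator R a)"
  proof (rule bij_betw_same_card[of "\<lambda>v. v i"], rule bij_betwI')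
    fix u v assume uv: "u \<in> ?K" "v \<in> ?K"
    then have "u \<in> insert i I \<rightarrow>\<^sub>E carrier R" "v \<in> insert i I \<rightarrow>\<^sub>E carrier R"
      using linear_on_carrier[OF linD] by auto
    then show "u i = v i \<longleftrightarrow> u = v"
      using uv by (metis (mono_tags, lifting) PiE_ext insertE mem_Collect_eq)
  next
    fix v assume v: "v \<in> ?K"
    then have vE: "v \<in> insert i I \<rightarrow>\<^sub>E carrier R"
      using linear_on_carrier[OF linD] by auto
    have "dot I g v = dot I g (\<lambda>l\<in>I. \<zero>)"
      using v gcarr by (intro dot_cong) auto
    then have "dot I g v = \<zero>" using gcarr by (simp add: dot_zero_right)
    moreover have vi: "v i \<in> carrier R" using v by (intro Dcarr) auto
    moreover have "a \<otimes> v i \<oplus> dot I g v = \<zero>" using v dual_iff[OF vE] by blast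
    ultimately show "v i \<in> annihilator R a"
      using a(1) by (simp add: annihilator_def)
  next
    fix s assume s: "s \<in> annihilator R a"
    then have sc: "s \<in> carrier R" "a \<otimes> s = \<zero>" by (auto simp: annihilator_def)
    let ?v = "\<lambda>l\<in>insert i I. if l = i then s else \<zero>"
    have vE: "?v \<in> insert i I \<rightarrow>\<^sub>E carrier R" using sc by auto
    have "dot I g ?v = dot I g (\<lambda>l\<in>I. \<zero>)"
      using gcarr insert.hyps by (intro dot_cong) auto
    then have "dot I g ?v = \<zero>" using gcarr by (simp add: dot_zero_right)
    moreover have "restrict ?v I = (\<lambda>l\<in>I. \<zero>)" using insert.hyps by auto
    ultimately have "?v \<in> ?D"
      using dual_iff[OF vE] sc linear_on_zero[OF linear_on_dual_on[OF insert.hyps(1) linC']]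
      by simp
    then have "?v \<in> ?K" using insert.hyps by auto
    then show "\<exists>v\<in>?K. s = v i" by (rule bexI[rotated]) simp
  qed
  have "card C * card ?D =
      (card (PIdl a) * card (annihilator R a)) * (card C' * card (dual_on I C'))"
    by (simp add: C D K card_C')
  also have "\<dots> = card (carrier R) ^ card (insert i I)"
    using insert.IH[OF linC'] insert.hyps card_cgenideal_annihilator[OF a(1)] by simp
  finally show ?case .
qed

text \<open>Multiplying the coordinates by \<open>b\<close> is a map \<open>\<beta>\<close> that is
  self-adjoint for \<open>dot\<close>. Hence \<open>\<beta> v\<close> lies in the dual of
  \<open>C\<close> exactly if \<open>v\<close> lies in the dual of \<open>\<beta>\<close>
  C\<open>, and\<close>\<beta>\<open>maps that dual onto the set on the left. Fibre counting on\<close>C\<open>and on this dual, with\<close>card_dual_on\<open>for\<close>\<beta>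
  \<open>C\<close>, gives the identity.\<close>

lemma card_dual_on_inter:
  fixes I :: "'i set"
  assumes fin: "finite I" and lin: "linear_on I C"
    and b: "\<And>l. l \<in> I \<Longrightarrow> b l \<in> carrier R"
  shows "card C * card {v \<in> dual_on I C. \<forall>l\<in>I. v l \<in> PIdl (b l)} =
    (\<Prod>l\<in>I. card (PIdl (b l))) * card {u \<in> C. \<forall>l\<in>I. u l \<in> annihilator R (b l)}"
proof -
  define \<beta> where "\<beta> u = (\<lambda>l\<in>I. b l \<otimes> u l)" for u :: "'i \<Rightarrow> 'a"
  let ?A = "\<lambda>l. annihilator R (b l)"
  have \<beta>_add: "\<beta> (\<lambda>l\<in>I. u l \<oplus> v l) = (\<lambda>l\<in>I. \<beta> u l \<oplus> \<beta> v l)"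
    if "u \<in> I \<rightarrow> carrier R" "v \<in> I \<rightarrow> carrier R" for u v
    using that b by (auto simp: \<beta>_def Pi_iff r_distr)
  have \<beta>_smult: "\<beta> (\<lambda>l\<in>I. r \<otimes> u l) = (\<lambda>l\<in>I. r \<otimes> \<beta> u l)"
    if "r \<in> carrier R" "u \<in> I \<rightarrow> carrier R" for r u
    using that b by (auto simp: \<beta>_def Pi_iff m_lcomm)
  have \<beta>_zero: "\<beta> (\<lambda>l\<in>I. \<zero>) = (\<lambda>l\<in>I. \<zero>)"
    using b by (auto simp: \<beta>_def)
  have \<beta>_carr: "\<beta> u \<in> I \<rightarrow>\<^sub>E carrier R" if "u \<in> I \<rightarrow> carrier R" for u
    using that b by (auto simp: \<beta>_def)
  have Pi: "u \<in> I \<rightarrow> carrier R" if "linear_on I G" "u \<in> G" for u G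
    using linear_on_carrier[OF that] by (rule PiE_imp_funcset)
  have \<beta>_fibre: "\<beta> (\<lambda>l\<in>I. y l \<oplus> x l) = \<beta> y \<longleftrightarrow> x \<in> {u \<in> G. \<forall>l\<in>I. u l \<in> ?A l}"
    if G: "linear_on I G" and x: "x \<in> G" and y: "y \<in> G" for x y G
  proof -
    have "b l \<otimes> (y l \<oplus> x l) = b l \<otimes> y l \<longleftrightarrow> x l \<in> ?A l" if "l \<in> I" for l
      using that b[OF that] linear_on_closed[OF G x that] linear_on_closed[OF G y that]
      by (simp add: r_distr annihilator_def)
    then show ?thesis
      using x by (auto simp: \<beta>_def fun_eq_iff)
  qed
  have card_\<beta>: "card G = card (\<beta> ` G) * card {u \<in> G. \<forall>l\<in>I. u l \<in> ?A l}"
    if "linear_on I G" for G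
    using fin that by (rule card_linear_on_image) (auto simp: \<beta>_fibre[OF that])
  have lin\<beta>: "linear_on I (\<beta> ` C)"
    unfolding linear_on_def
  proof (intro conjI ballI subsetI)
    show "(\<lambda>l\<in>I. \<zero>) \<in> \<beta> ` C"
      using linear_on_zero[OF lin] \<beta>_zero by (metis imageI)
  next
    fix u v assume "u \<in> \<beta> ` C" "v \<in> \<beta> ` C"
    then show "(\<lambda>l\<in>I. u l \<oplus> v l) \<in> \<beta> ` C"
      using linear_on_add[OF lin] \<beta>_add Pi[OF lin] by (auto simp flip: \<beta>_add)
  next
    fix r u assume "r \<in> carrier R" "u \<in> \<beta> ` C"
    then show "(\<lambda>l\<in>I. r \<otimes> u l) \<in> \<beta> ` C"
      using linear_on_smult[OF lin] Pi[OF lin] by (auto simp flip: \<beta>_smult)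
  qed (use \<beta>_carr Pi[OF lin] in auto)
  let ?D = "dual_on I (\<beta> ` C)"
  have linD: "linear_on I ?D" using linear_on_dual_on[OF fin lin\<beta>] .
  have dot_\<beta>: "dot I (\<beta> u) v = dot I u (\<beta> v)"
    if "u \<in> I \<rightarrow> carrier R" "v \<in> I \<rightarrow> carrier R" for u v
    using that b by (intro dot_cong) (auto simp: \<beta>_def Pi_iff m_ac)
  have D_iff: "v \<in> ?D \<longleftrightarrow> v \<in> I \<rightarrow>\<^sub>E carrier R \<and> \<beta> v \<in> dual_on I C" for v
    using Pi[OF lin] \<beta>_carr[of v] by (auto simp: dual_on_def dot_\<beta> PiE_imp_funcset)
  have kernel: "{v \<in> ?D. \<forall>l\<in>I. v l \<in> ?A l} = (\<Pi>\<^sub>E l\<in>I. ?A l)"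
  proof (intro equalityI subsetI)
    fix v assume v: "v \<in> (\<Pi>\<^sub>E l\<in>I. ?A l)"
    then have "\<beta> v = (\<lambda>l\<in>I. \<zero>)"
      by (auto simp: \<beta>_def annihilator_def PiE_iff)
    then have "\<beta> v \<in> dual_on I C"
      using linear_on_zero[OF linear_on_dual_on[OF fin lin]] by simp
    moreover have "v \<in> I \<rightarrow>\<^sub>E carrier R"
      using v by (auto simp: annihilator_def PiE_iff)
    ultimately show "v \<in> {v \<in> ?D. \<forall>l\<in>I. v l \<in> ?A l}"
      using v D_iff by auto
  qed (auto simp: dual_on_def PiE_iff)
  have image: "\<beta> ` ?D = {v \<in> dual_on I C. \<forall>l\<in>I. v l \<in> PIdl (b l)}"
  proof (intro equalityI subsetI)
    fix v assume "v \<in> \<beta> ` ?D"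
    then obtain w where w: "v = \<beta> w" "w \<in> ?D" by blast
    then have "v l \<in> PIdl (b l)" if "l \<in> I" for l
      using that b[OF that] linear_on_closed[OF linD w(2) that] w(1)
      by (auto simp: \<beta>_def mem_cgenideal_iff intro: m_comm)
    then show "v \<in> {v \<in> dual_on I C. \<forall>l\<in>I. v l \<in> PIdl (b l)}"
      using w D_iff by auto
  next
    fix v assume v: "v \<in> {v \<in> dual_on I C. \<forall>l\<in>I. v l \<in> PIdl (b l)}"
    then have "\<forall>l\<in>I. \<exists>r\<in>carrier R. v l = r \<otimes> b l"
      by (auto simp: mem_cgenideal_iff)
    then obtain w where w: "\<And>l. l \<in> I \<Longrightarrow> w l \<in> carrier R \<and> v l = w l \<otimes> b l"
      by metis
    have "v \<in> extensional I" using v by (auto simp: dual_on_def PiE_iff)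
    then have "\<beta> (restrict w I) = v"
      using w b by (intro ext) (auto simp: \<beta>_def extensional_def m_comm)
    moreover have "restrict w I \<in> ?D"
      using calculation v w by (auto simp: D_iff)
    ultimately show "v \<in> \<beta> ` ?D" by blast
  qed
  \<comment> \<open>Each factor \<open>|R|\<close> of the total splits as
    \<open>|b\<^sub>lR|\<close> times the size of the annihilator of \<open>b\<^sub>l\<close>; the
    annihilators cancel below against the kernel of \<open>\<beta>\<close> on
    \<open>?D\<close>.\<close>
  have total: "card (\<beta> ` C) * card ?D = (\<Prod>l\<in>I. card (PIdl (b l))) * (\<Prod>l\<in>I. card (?A l))"
    using card_dual_on[OF fin lin\<beta>] b
    by (simp add: card_cgenideal_annihilator flip: prod.distrib)
  have "(\<Prod>l\<in>I. card (?A l)) > 0"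
    using b by (intro prod_pos) (simp add: card_annihilator_pos)
  moreover have "card ?D = card (\<beta> ` ?D) * (\<Prod>l\<in>I. card (?A l))"
    using card_\<beta>[OF linD] fin by (simp add: kernel card_PiE)
  ultimately have "card (\<beta> ` C) * card (\<beta> ` ?D) = (\<Prod>l\<in>I. card (PIdl (b l)))"
    using total by simp
  then show ?thesis
    by (simp add: card_\<beta>[OF lin] mult_ac flip: image)
qed

lemma linear_code_imp_linear_on:
  assumes "linear_code R n C"
  shows "linear_on {1..n} C"
proof -
  interpret submodule C R "word_module R n"
    using assms by (simp add: linear_code_def)
  interpret W: module R "word_module R n"
    using module_word_module[OF is_cring] .
  show ?thesis
    using subset m_closed one_closed smult_closed
    by (auto simp: linear_on_def word_module_def)
qed

lemma dual_code_eq: "dual_code R n C = dual_on {1..n} C"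
  by (simp add: dual_code_def dual_on_def dot_def)

end

section \<open>Expansion of the enumerator and invertibility of the matrix A\<close>

locale ideal_numbering = finite_principal_ideal_ring +
  fixes t :: nat and a :: "nat \<Rightarrow> 'a"
  assumes t: "t = num_nonzero_principal_ideals R"
    and a_closed [simp]: "i \<le> t \<Longrightarrow> a i \<in> carrier R"
    and inj: "inj_on (\<lambda>i. PIdl (a i)) {0..t}"
begin

text \<open>The zero ideal and the \<open>t\<close> nonzero principal ideals make
  \<open>t + 1\<close> in all. The numbering yields \<open>t + 1\<close> distinct ones, hence all of
  them, and every ideal is principal.\<close>

lemma ideal_eq_numbered:
  assumes "ideal J R"
  obtains i where "i \<le> t" "J = PIdl (a i)"
proof -
  let ?P = "{I. \<exists>b\<in>carrier R. I = PIdl b}"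
  have P: "?P = insert {\<zero>} {I. (\<exists>b\<in>carrier R. I = PIdl b) \<and> I \<noteq> {\<zero>}}"
  proof -
    have "PIdl \<zero> = {\<zero>}" using cgenideal_eq_genideal genideal_zero by simp
    then show ?thesis using zero_closed by blast
  qed
  have "?P = (\<lambda>b. PIdl b) ` carrier R" by auto
  then have fin: "finite ?P" using finite_carrier by simp
  have "finite {I. (\<exists>b\<in>carrier R. I = PIdl b) \<and> I \<noteq> {\<zero>}}"
    by (rule finite_subset[OF _ fin]) auto
  then have "card ?P = Suc t"
    unfolding t num_nonzero_principal_ideals_def by (subst P) simp
  moreover have "card ((\<lambda>i. PIdl (a i)) ` {0..t}) = Suc t"
    using inj by (simp add: card_image)
  moreover have "(\<lambda>i. PIdl (a i)) ` {0..t} \<subseteq> ?P" by auto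
  ultimately have "(\<lambda>i. PIdl (a i)) ` {0..t} = ?P"
    using fin by (intro card_subset_eq) auto
  moreover have "J \<in> ?P" using ideal_principal[OF assms] by blast
  ultimately have "J \<in> (\<lambda>i. PIdl (a i)) ` {0..t}" by simp
  then show ?thesis using that by auto
qed

text \<open>Positions are regrouped by the index of the ideal that the tuple generates there, which
  turns the product over indices into one over positions. The family \<open>N\<close> is general
  because two are used: \<open>N j = a\<^sub>jR\<close> for the dual code and
  \<open>N j = (a\<^sub>jR)\<^sup>\<bottom>\<close> for \<open>C\<close>.\<close>

lemma prod_ideal_positions:
  fixes x :: "'p::comm_ring_1 vec"
  assumes c: "\<And>m l. m \<in> {1..k} \<Longrightarrow> l \<in> {1..n} \<Longrightarrow> c m l \<in> carrier R"
    and N: "\<And>j. j \<le> t \<Longrightarrow> ideal (N j) R"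
    and x: "\<And>i. i \<le> t \<Longrightarrow> x $ i = (\<Sum>j\<in>{0..t}. if PIdl (a i) \<subseteq> N j then w j else 0)"
  shows "(\<Prod>i\<in>{0..t}. (x $ i) ^ card (ideal_positions R n a k c i)) =
    (\<Prod>l\<in>{1..n}. \<Sum>j\<in>{0..t}. if \<forall>m\<in>{1..k}. c m l \<in> N j then w j else 0)"
proof -
  let ?S = "\<lambda>l. ideal_sum R {1..k} (\<lambda>m. PIdl (c m l))"
  have "\<forall>l\<in>{1..n}. \<exists>i. i \<le> t \<and> ?S l = PIdl (a i)"
    by (metis ideal_eq_numbered ideal_ideal_sum[OF finite_atLeastAtMost] c)
  then obtain p where p: "\<And>l. l \<in> {1..n} \<Longrightarrow> p l \<le> t \<and> ?S l = PIdl (a (p l))"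
    by metis
  have pos: "ideal_positions R n a k c i = {l \<in> {1..n}. p l = i}" if "i \<in> {0..t}" for i
    using p inj_onD[OF inj] that by (force simp: ideal_positions_def)
  have "(\<Prod>i\<in>{0..t}. (x $ i) ^ card (ideal_positions R n a k c i)) =
      (\<Prod>i\<in>{0..t}. \<Prod>l\<in>{l \<in> {1..n}. p l = i}. x $ p l)"
    by (intro prod.cong refl) (simp add: pos)
  also have "\<dots> = (\<Prod>l\<in>{1..n}. x $ p l)"
    using p by (intro prod.group) auto
  also have "\<dots> = (\<Prod>l\<in>{1..n}. \<Sum>j\<in>{0..t}. if \<forall>m\<in>{1..k}. c m l \<in> N j then w j else 0)"
  proof (rule prod.cong[OF refl])
    fix l assume l: "l \<in> {1..n}"
    have "?S l \<subseteq> N j \<longleftrightarrow> (\<forall>m\<in>{1..k}. c m l \<in> N j)" if "j \<le> t" for j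
      using c l N[OF that] by (intro ideal_sum_subset_iff) auto
    then show "x $ p l = (\<Sum>j\<in>{0..t}. if \<forall>m\<in>{1..k}. c m l \<in> N j then w j else 0)"
      using p[OF l] x[of "p l"] by (auto intro!: sum.cong)
  qed
  finally show ?thesis .
qed

text \<open>Expanding the product of sums chooses an index \<open>J l\<close> at every position. For
  fixed \<open>J\<close> the conditions on the \<open>k\<close> words are independent and identical,
  which gives the \<open>k\<close>-th power of a count of single words.\<close>

lemma swe_expand:
  fixes x :: "'p::comm_ring_1 vec"
  assumes C: "linear_on {1..n} C"
    and N: "\<And>j. j \<le> t \<Longrightarrow> ideal (N j) R"
    and x: "\<And>i. i \<le> t \<Longrightarrow> x $ i = (\<Sum>j\<in>{0..t}. if PIdl (a i) \<subseteq> N j then w j else 0)"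
  shows "swe R n t a k C x =
    (\<Sum>J \<in> {1..n} \<rightarrow>\<^sub>E {0..t}. (\<Prod>l\<in>{1..n}. w (J l)) *
      of_nat (card {u \<in> C. \<forall>l\<in>{1..n}. u l \<in> N (J l)}) ^ k)"
proof -
  have finC: "finite C" using finite_linear_on[OF _ C] by simp
  let ?Js = "{1..n} \<rightarrow>\<^sub>E {0..t}"
  let ?S = "\<lambda>J. {u \<in> C. \<forall>l\<in>{1..n}. u l \<in> N (J l)}"
  let ?w = "\<lambda>J. \<Prod>l\<in>{1..n}. w (J l)"
  have "swe R n t a k C x = (\<Sum>c \<in> {1..k} \<rightarrow>\<^sub>E C. \<Prod>l\<in>{1..n}. \<Sum>j\<in>{0..t}.
      if \<forall>m\<in>{1..k}. c m l \<in> N j then w j else 0)"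
    unfolding swe_def
    using linear_on_closed[OF C] N x
    by (intro sum.cong refl prod_ideal_positions) (auto simp: PiE_iff)
  also have "\<dots> = (\<Sum>c \<in> {1..k} \<rightarrow>\<^sub>E C. \<Sum>J\<in>?Js. \<Prod>l\<in>{1..n}.
      if \<forall>m\<in>{1..k}. c m l \<in> N (J l) then w (J l) else 0)"
    by (intro sum.cong refl prod_sum_PiE) auto
  also have "\<dots> = (\<Sum>c \<in> {1..k} \<rightarrow>\<^sub>E C. \<Sum>J\<in>?Js. if c \<in> {1..k} \<rightarrow>\<^sub>E ?S J then ?w J else 0)"
  proof (intro sum.cong refl)
    fix c J assume c: "c \<in> {1..k} \<rightarrow>\<^sub>E C"
    show "(\<Prod>l\<in>{1..n}. if \<forall>m\<in>{1..k}. c m l \<in> N (J l) then w (J l) else 0) =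
        (if c \<in> {1..k} \<rightarrow>\<^sub>E ?S J then ?w J else 0)"
    proof (cases "\<forall>l\<in>{1..n}. \<forall>m\<in>{1..k}. c m l \<in> N (J l)")
      case True
      then have "c \<in> {1..k} \<rightarrow>\<^sub>E ?S J" using c by (auto simp: PiE_iff)
      then show ?thesis using True by simp
    next
      case False
      then have "c \<notin> {1..k} \<rightarrow>\<^sub>E ?S J" by (auto simp: PiE_iff)
      moreover have "(\<Prod>l\<in>{1..n}. if \<forall>m\<in>{1..k}. c m l \<in> N (J l) then w (J l) else 0) = 0"
        using False by (intro prod_zero) auto
      ultimately show ?thesis by simp
    qed
  qed
  also have "\<dots> = (\<Sum>J\<in>?Js. \<Sum>c \<in> {1..k} \<rightarrow>\<^sub>E C. if c \<in> {1..k} \<rightarrow>\<^sub>E ?S J then ?w J else 0)"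
    by (rule sum.swap)
  also have "\<dots> = (\<Sum>J\<in>?Js. ?w J * of_nat (card (?S J)) ^ k)"
  proof (rule sum.cong[OF refl])
    fix J
    have "(\<Sum>c \<in> {1..k} \<rightarrow>\<^sub>E C. if c \<in> {1..k} \<rightarrow>\<^sub>E ?S J then ?w J else 0) =
        (\<Sum>c \<in> ({1..k} \<rightarrow>\<^sub>E C) \<inter> ({1..k} \<rightarrow>\<^sub>E ?S J). ?w J)"
      using finC by (intro sum.inter_restrict[symmetric] finite_PiE) auto
    also have "({1..k} \<rightarrow>\<^sub>E C) \<inter> ({1..k} \<rightarrow>\<^sub>E ?S J) = {1..k} \<rightarrow>\<^sub>E ?S J"
      by (auto simp: PiE_iff)
    finally show "(\<Sum>c \<in> {1..k} \<rightarrow>\<^sub>E C. if c \<in> {1..k} \<rightarrow>\<^sub>E ?S J then ?w J else 0) =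
        ?w J * of_nat (card (?S J)) ^ k"
      by (simp add: card_PiE mult.commute)
  qed
  finally show ?thesis .
qed

lemma A_mat_carrier [simp]: "A_mat R t a \<in> carrier_mat (t + 1) (t + 1)"
  by (simp add: A_mat_def)

text \<open>With the ideals ordered by inclusion the matrix is triangular with unit diagonal. The
  entries of \<open>v\<close> vanish one after another, starting from the largest ideals; the
  induction measure is \<open>|R| - |a\<^sub>iR|\<close>.\<close>

lemma A_mat_kernel:
  assumes v: "v \<in> carrier_vec (t + 1)" and Av: "A_mat R t a *\<^sub>v v = 0\<^sub>v (t + 1)"
  shows "v = 0\<^sub>v (t + 1)"
proof -
  have fin: "finite (PIdl (a i))" for i
    using finite_carrier by (auto simp: cgenideal_def)
  have "v $ i = 0" if "i \<le> t" for i
    using that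
  proof (induction "card (carrier R) - card (PIdl (a i))" arbitrary: i rule: less_induct)
    case less
    have "0 = (A_mat R t a *\<^sub>v v) $ i" using Av less.prems by simp
    also have "\<dots> = (\<Sum>j\<in>{0..<t + 1}. (if PIdl (a i) \<subseteq> PIdl (a j) then 1 else 0) * v $ j)"
      using v less.prems by (simp add: A_mat_def scalar_prod_def)
    \<comment> \<open>Since the numbering is injective, any other ideal in row \<open>i\<close>
      contains \<open>a\<^sub>iR\<close> strictly, so its entry of \<open>v\<close> is already known
      to be zero.\<close>
    also have "\<dots> = (\<Sum>j\<in>{0..<t + 1}. if j = i then v $ i else 0)"
    proof (rule sum.cong[OF refl])
      fix j assume j: "j \<in> {0..<t + 1}"
      have "v $ j = 0" if sub: "PIdl (a i) \<subseteq> PIdl (a j)" and "j \<noteq> i"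
      proof (rule less.hyps)
        have "PIdl (a i) \<noteq> PIdl (a j)"
          using inj_onD[OF inj, of i j] j less.prems \<open>j \<noteq> i\<close> by auto
        then have "card (PIdl (a i)) < card (PIdl (a j))"
          using sub fin by (intro psubset_card_mono) auto
        moreover have "card (PIdl (a j)) \<le> card (carrier R)"
          using finite_carrier j by (intro card_mono) (auto simp: cgenideal_def)
        ultimately show "card (carrier R) - card (PIdl (a j)) < card (carrier R) - card (PIdl (a i))"
          by simp
      qed (use j in auto)
      then show "(if PIdl (a i) \<subseteq> PIdl (a j) then 1 else 0) * v $ j = (if j = i then v $ i else 0)"
        by auto
    qed
    also have "\<dots> = v $ i" using less.prems by simp
    finally show ?case by simp
  qed
  then show ?thesis using v by (intro eq_vecI) auto
qed

text \<open>A trivial kernel over a field gives a nonzero determinant, so \<open>mat_inverse\<close>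
  returns a matrix. The identity on this side yields \<open>Ay = x\<close> for
  \<open>y = Bx\<close>.\<close>

lemma mat_inverse_A_mat:
  obtains B where "mat_inverse (A_mat R t a) = Some B" "B \<in> carrier_mat (t + 1) (t + 1)"
    "A_mat R t a * B = 1\<^sub>m (t + 1)"
proof -
  have "det (A_mat R t a) \<noteq> 0"
    using A_mat_kernel det_0_iff_vec_prod_zero_field[OF A_mat_carrier] by blast
  then have "A_mat R t a \<in> Units (ring_mat TYPE(rat) (t + 1) ())"
    by (rule det_non_zero_imp_unit[OF A_mat_carrier])
  then obtain B where B: "mat_inverse (A_mat R t a) = Some B"
    using mat_inverse(1)[OF A_mat_carrier, of "()"] by fastforce
  then show ?thesis
    using that mat_inverse(2)[OF A_mat_carrier B] by blast
qed

end

section \<open>The identity for polynomials, first after the substitution x = Ay\<close>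

interpretation Const: comm_ring_hom Const
  by unfold_locales (simp_all add: Const_def single_add mult_single)

lemma mat_diag_pow: "mat_diag n f ^\<^sub>m k = mat_diag n (\<lambda>i. f i ^ k)"
proof (induction k)
  case (Suc k)
  then show ?case by (simp add: power_commutes)
qed (simp add: mat_diag_def one_mat_def)

context ideal_numbering
begin

text \<open>In terms of \<open>y\<close> no inverse occurs, and both sides expand by
  \<open>swe_expand\<close> into sums over the same index maps \<open>J\<close>, to be compared term
  by term.\<close>

theorem swe_dual_code:
  fixes y :: "rat_mpoly vec"
  assumes C: "linear_code R n C" and y: "y \<in> carrier_vec (t + 1)"
  shows "swe R n t a k (dual_code R n C) (map_mat Const (A_mat R t a) *\<^sub>v y) =
    Const (1 / of_nat (card C) ^ k) *
      swe R n t a k C (map_mat Const (Q_mat R t a * D_mat R t a ^\<^sub>m k) *\<^sub>v y)"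
proof -
  let ?I = "{1..n}" and ?Js = "{1..n} \<rightarrow>\<^sub>E {0..t}"
  let ?d = "\<lambda>j. card (PIdl (a j))"
  have lin: "linear_on ?I C" using linear_code_imp_linear_on[OF C] .
  have linD: "linear_on ?I (dual_on ?I C)"
    by (intro linear_on_dual_on lin) simp
  have cC: "card C \<noteq> 0"
    using finite_linear_on[OF _ lin] linear_on_zero[OF lin] by auto
  have L: "swe R n t a k (dual_code R n C) (map_mat Const (A_mat R t a) *\<^sub>v y) =
    (\<Sum>J\<in>?Js. (\<Prod>l\<in>?I. y $ J l) *
      of_nat (card {v \<in> dual_on ?I C. \<forall>l\<in>?I. v l \<in> PIdl (a (J l))}) ^ k)"
    unfolding dual_code_eq
  proof (rule swe_expand[OF linD])
    fix i assume "i \<le> t"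
    then show "(map_mat Const (A_mat R t a) *\<^sub>v y) $ i =
        (\<Sum>j\<in>{0..t}. if PIdl (a i) \<subseteq> PIdl (a j) then y $ j else 0)"
      using y by (auto simp: A_mat_def scalar_prod_def atLeastLessThanSuc_atLeastAtMost
          intro!: sum.cong)
  qed (auto intro: cgenideal_ideal)
  \<comment> \<open>The diagonal factor scales column \<open>j\<close> by
    \<open>|a\<^sub>jR|^k\<close>, which joins \<open>y $ j\<close> in the weight of the index
    \<open>j\<close>.\<close>
  have QD: "Q_mat R t a * D_mat R t a ^\<^sub>m k = mat (t + 1) (t + 1)
      (\<lambda>(i, j). (if PIdl (a j) \<subseteq> annihilator R (a i) then 1 else 0) * of_nat (?d j) ^ k)"
    unfolding D_mat_def mat_diag_pow
    by (subst mat_diag_mult_right[of _ "t + 1"]) (auto simp: Q_mat_def)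
  have R: "swe R n t a k C (map_mat Const (Q_mat R t a * D_mat R t a ^\<^sub>m k) *\<^sub>v y) =
    (\<Sum>J\<in>?Js. (\<Prod>l\<in>?I. Const (of_nat (?d (J l)) ^ k) * y $ J l) *
      of_nat (card {u \<in> C. \<forall>l\<in>?I. u l \<in> annihilator R (a (J l))}) ^ k)"
  proof (rule swe_expand[OF lin])
    fix i assume i: "i \<le> t"
    \<comment> \<open>\<open>Q_mat\<close> is symmetric; the expansion asks for the row ideal
      \<open>a\<^sub>iR\<close> on the left of the inclusion.\<close>
    have "PIdl (a j) \<subseteq> annihilator R (a i) \<longleftrightarrow> PIdl (a i) \<subseteq> annihilator R (a j)" if "j \<le> t" for j
      using i that by (simp add: cgenideal_subset_iff ideal_annihilator annihilator_commute)
    then show "(map_mat Const (Q_mat R t a * D_mat R t a ^\<^sub>m k) *\<^sub>v y) $ i =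
        (\<Sum>j\<in>{0..t}. if PIdl (a i) \<subseteq> annihilator R (a j)
          then Const (of_nat (?d j) ^ k) * y $ j else 0)"
      using y i by (auto simp: QD scalar_prod_def atLeastLessThanSuc_atLeastAtMost
          intro!: sum.cong)
  qed (auto intro: ideal_annihilator)
  show ?thesis
    unfolding L R sum_distrib_left
  proof (rule sum.cong[OF refl])
    fix J assume J: "J \<in> ?Js"
    define p q where "p = card {v \<in> dual_on ?I C. \<forall>l\<in>?I. v l \<in> PIdl (a (J l))}"
      and "q = card {u \<in> C. \<forall>l\<in>?I. u l \<in> annihilator R (a (J l))}"
    \<comment> \<open>The counting identity for the ideals chosen by \<open>J\<close>. The rest
      divides it by \<open>|C|\<close>, raises it to the power \<open>k\<close> and carries it into
      the polynomial ring by the homomorphism \<open>Const\<close>.\<close>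
    have "card C * p = (\<Prod>l\<in>?I. ?d (J l)) * q"
      unfolding p_def q_def using J lin by (intro card_dual_on_inter) (auto simp: PiE_iff)
    then have "rat_of_nat (card C) * of_nat p = (\<Prod>l\<in>?I. of_nat (?d (J l))) * of_nat q"
      by (metis of_nat_mult of_nat_prod)
    then have "rat_of_nat p = 1 / of_nat (card C) * (\<Prod>l\<in>?I. of_nat (?d (J l))) * of_nat q"
      using cC by (simp add: field_simps)
    then have "rat_of_nat p ^ k =
        1 / of_nat (card C) ^ k * (\<Prod>l\<in>?I. of_nat (?d (J l)) ^ k) * of_nat q ^ k"
      by (simp add: power_mult_distrib power_divide prod_power_distrib)
    then have "Const (rat_of_nat p ^ k) =
        Const (1 / of_nat (card C) ^ k * (\<Prod>l\<in>?I. of_nat (?d (J l)) ^ k) * of_nat q ^ k)"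
      by simp
    then have "of_nat p ^ k = Const (1 / of_nat (card C) ^ k) *
        (\<Prod>l\<in>?I. Const (of_nat (?d (J l)) ^ k)) * of_nat q ^ k"
      by (simp only: Const.hom_mult Const.hom_prod Const.hom_power Const.hom_of_nat)
    then show "(\<Prod>l\<in>?I. y $ J l) * of_nat p ^ k = Const (1 / of_nat (card C) ^ k) *
        ((\<Prod>l\<in>?I. Const (of_nat (?d (J l)) ^ k) * y $ J l) * of_nat q ^ k)"
      by (simp only: prod.distrib mult_ac)
  qed
qed

end

theorem corollary19:
  fixes R :: "('a, 'm) ring_scheme"
    and n t k :: nat
    and a :: "nat \<Rightarrow> 'a"
    and C :: "(nat \<Rightarrow> 'a) set"
  assumes "finite_principal_ideal_ring R"
    and "linear_code R n C"
    and "k > 0"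
    and "t = num_nonzero_principal_ideals R"
    and "\<And>i. i \<in> {0..t} \<Longrightarrow> a i \<in> carrier R"
    and "inj_on (\<lambda>i. PIdl\<^bsub>R\<^esub> (a i)) {0..t}"
  shows "swe R n t a k (dual_code R n C) (indets t) =
    Const (1 / of_nat (card C) ^ k) *
    swe R n t a k C
      (map_mat Const (Q_mat R t a * D_mat R t a ^\<^sub>m k * the (mat_inverse (A_mat R t a)))
        *\<^sub>v indets t)"
proof -
  interpret ideal_numbering R t a
  proof (intro ideal_numbering.intro ideal_numbering_axioms.intro)
    show "a i \<in> carrier R" if "i \<le> t" for i
      using assms(5) that by simp
  qed (fact assms)+
  obtain B where B: "mat_inverse (A_mat R t a) = Some B" "B \<in> carrier_mat (t + 1) (t + 1)"
    "A_mat R t a * B = 1\<^sub>m (t + 1)"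
    by (rule mat_inverse_A_mat)
  \<comment> \<open>The vector with \<open>Ay = x\<close>, so that \<open>swe_dual_code\<close>
    speaks about the indeterminates themselves.\<close>
  define y where "y = map_mat Const B *\<^sub>v indets t"
  have ind: "indets t \<in> carrier_vec (t + 1)" by (simp add: indets_def)
  have y: "y \<in> carrier_vec (t + 1)" using ind B(2) unfolding y_def by (intro mult_mat_vec_carrier) auto
  have QD: "Q_mat R t a * D_mat R t a ^\<^sub>m k \<in> carrier_mat (t + 1) (t + 1)"
    by (intro mult_carrier_mat[of _ _ "t + 1"] pow_carrier_mat) (auto simp: Q_mat_def D_mat_def)
  have "map_mat Const (A_mat R t a) *\<^sub>v y = map_mat Const (A_mat R t a * B) *\<^sub>v indets t"
    unfolding y_def Const.mat_hom_mult[OF A_mat_carrier B(2)]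
    using ind B(2) A_mat_carrier
    by (intro assoc_mult_mat_vec[symmetric, of _ "t + 1" "t + 1"]) auto
  also have "\<dots> = indets t"
    using ind by (simp add: B(3) Const.mat_hom_one)
  finally have A: "map_mat Const (A_mat R t a) *\<^sub>v y = indets t" .
  have "map_mat Const (Q_mat R t a * D_mat R t a ^\<^sub>m k * B) *\<^sub>v indets t =
      map_mat Const (Q_mat R t a * D_mat R t a ^\<^sub>m k) *\<^sub>v y"
    unfolding y_def Const.mat_hom_mult[OF QD B(2)]
    using ind B(2) QD by (intro assoc_mult_mat_vec[of _ "t + 1" "t + 1"]) auto
  then show ?thesis
    using swe_dual_code[OF assms(2) y, of k] by (simp add: A B(1))
qed

end
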